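(* Let $k\in\mathbb{N}$, $p$ a prime and $a\in\mathbb{Z}$ with $p\nmid a$, and assume $\left(\frac{a}{p}\right)_{2^{k-1}}=1$. Let $\phi_a$ be the permutation of $\mathbb{Z}_p$ given by $x \bmod p\mapsto ax \bmod p$. Then $\phi_a$ restricts to a permutation of $\mathbb{Z}_{p,2^{k-1}}^*$ and \[ \left(\frac{a}{p}\right)_{2^k}=\operatorname{sgn}\left(\phi_a|_{\mathbb{Z}_{p,2^{k-1}}^*}\right). \]
   Context: For $k\in\mathbb{N}_0$, a prime $p$ and $a\in\mathbb{Z}$ with $p\nmid a$, $\left(\frac{a}{p}\right)_{2^k}=1$ if there is $x\in\mathbb{Z}$ with $x^{2^k}\equiv a \pmod p$, and $-1$ otherwise. $\mathbb{Z}_{p,2^{j}}^*$ denotes the subgroup of $\mathbb{Z}_p^*$ consisting of the $2^j$-th powers of units modulo $p$. No assumption $p\equiv 1\pmod{2^k}$ is made. *)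

theory Defs
  imports "HOL-Number_Theory.Residues" "HOL-Combinatorics.Permutations"
begin

(* Only meaningful if p does not divide a; no special value is given to the excluded case. *)
definition pow2_residue_symbol :: "nat \<Rightarrow> int \<Rightarrow> nat \<Rightarrow> int" where
  "pow2_residue_symbol k a p = (if \<exists>x::int. [x ^ (2 ^ k) = a] (mod int p) then 1 else - 1)"

definition pow2_power_units :: "nat \<Rightarrow> nat \<Rightarrow> int set" where
  "pow2_power_units p j =
     (\<lambda>x. x [^]\<^bsub>residue_ring (int p)\<^esub> ((2::nat) ^ j)) ` Units (residue_ring (int p))"

(* Residue classes modulo p are represented by 0, ..., p - 1, the carrier of residue_ring (int p);
   values outside this range are irrelevant. *)
definition mult_map :: "nat \<Rightarrow> int \<Rightarrow> int \<Rightarrow> int" where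
  "mult_map p a x = (a * x) mod int p"

end

theory Submission
  imports Defs "HOL-Number_Theory.Residue_Primitive_Roots" "HOL-Combinatorics.Cycles"
begin

text \<open>
  The group \<open>H\<close> of \<open>2 ^ (k - 1)\<close>-th powers is cyclic, generated by some \<open>h\<close> of order \<open>n\<close>.
  Multiplication by \<open>h\<close> is an \<open>n\<close>-cycle on \<open>H\<close>, so multiplication by \<open>a = h ^ i\<close> has sign
  \<open>(-1) ^ ((n - 1) * i)\<close>. On the other hand, \<open>a\<close> is a \<open>2 ^ k\<close>-th power iff it is a square in
  \<open>H\<close>, i.e. iff \<open>n\<close> is odd or \<open>i\<close> is even.
\<close>

section \<open>Signs of cyclic permutations\<close>

lemma sign_cycle_of_list:
  assumes "distinct cs"
  shows "sign (cycle_of_list cs) = (- 1) ^ (length cs - 1)"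
  using assms
proof (induction cs rule: cycle_of_list.induct)
  case (1 i j cs)
  \<comment> \<open>Each element beyond the first contributes one transposition.\<close>
  have "sign (cycle_of_list (i # j # cs)) = sign (transpose i j) * sign (cycle_of_list (j # cs))"
    unfolding cycle_of_list.simps
    by (intro sign_compose permutation_swap_id permutation_of_cycle)
  with 1 show ?case
    by (simp add: sign_swap_id del: cycle_of_list.simps)
qed auto

text \<open>Used for multiplication by a generator. Extended by the identity outside the set, as
  \<open>sign_on\<close> does, \<open>f\<close> is the cycle of the list of all \<open>c i\<close>
  with \<open>i < n\<close>.\<close>

lemma sign_on_cyclic_shift:
  fixes c :: "nat \<Rightarrow> 'a"
  assumes inj: "inj_on c {..<n}"
    and shift: "\<And>i. i < n \<Longrightarrow> f (c i) = c (Suc i mod n)"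
  shows "sign_on (c ` {..<n}) f = (- 1) ^ (n - 1)"
proof -
  define cs where "cs = map c [0..<n]"
  have set_cs: "set cs = c ` {..<n}"
    by (simp add: cs_def atLeast0LessThan)
  have dist: "distinct cs"
    using inj by (simp add: cs_def distinct_map atLeast0LessThan)
  have cycle_step: "cycle_of_list cs (c i) = c (Suc i mod n)" if "i < n" for i
  proof -
    have "map (cycle_of_list cs) cs ! i = rotate1 cs ! i"
      using cyclic_rotation[OF dist, of 1] by simp
    then show ?thesis
      using that by (simp add: cs_def nth_rotate1)
  qed
  have "restrict_id f (set cs) x = cycle_of_list cs x" for x
    using cycle_step shift id_outside_supp[of x cs] by (auto simp: restrict_id_def set_cs)
  then have "restrict_id f (c ` {..<n}) = cycle_of_list cs"
    by (auto simp: set_cs)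
  then show ?thesis
    using sign_cycle_of_list[OF dist] by (simp add: sign_on_def cs_def)
qed

section \<open>Multiplication modulo \<open>p\<close> and a generator of the units\<close>

lemma mult_map_mult: "mult_map p (a * b) x = mult_map p a (mult_map p b x)"
  by (simp add: mult_map_def mod_mult_right_eq mult.assoc)

lemma mult_map_cong: "[a = b] (mod int p) \<Longrightarrow> mult_map p a = mult_map p b"
  by (auto simp: mult_map_def fun_eq_iff cong_def intro: mod_mult_cong)

lemma inj_on_mult_map:
  assumes "coprime a (int p)" "S \<subseteq> {0..int p - 1}"
  shows "inj_on (mult_map p a) S"
proof (rule inj_onI)
  fix x y assume xy: "x \<in> S" "y \<in> S" "mult_map p a x = mult_map p a y"
  then have "[x = y] (mod int p)"
    using assms(1) by (simp add: mult_map_def cong_mult_lcancel flip: cong_def)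
  moreover have "0 \<le> x" "x < int p" "0 \<le> y" "y < int p"
    using assms(2) xy by auto
  ultimately show "x = y"
    by (simp add: cong_def)
qed

text \<open>Injectivity suffices because a set of residues is finite.\<close>

lemma bij_betw_mult_map:
  assumes "coprime a (int p)" "S \<subseteq> {0..int p - 1}" "mult_map p a ` S \<subseteq> S"
  shows "bij_betw (mult_map p a) S S"
  using inj_on_mult_map[OF assms(1,2)] assms(3) finite_subset[OF assms(2)]
  by (simp add: bij_betw_def endo_inj_surj)

text \<open>The generator is a primitive root. Its generating property is carried over from
  \<open>totatives p\<close> to arbitrary integers, since the residue symbol quantifies over
  integers.\<close>

lemma prime_units_cyclic:
  assumes "prime p"
  obtains g :: nat where "coprime p g"
    and "\<And>x::int. \<not> int p dvd x \<Longrightarrow> \<exists>i. [x = int g ^ i] (mod int p)"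
proof -
  have p1: "1 < p"
    using assms prime_gt_1_nat by blast
  obtain g where g: "residue_primroot p g"
    using prime_primitive_root_exists[of p] assms p1 by auto
  have "\<exists>i. [x = int g ^ i] (mod int p)" if "\<not> int p dvd x" for x
  proof -
    have "coprime x (int p)"
      using that assms by (metis coprime_commute prime_imp_coprime prime_nat_int_transfer)
    define y where "y = nat (x mod int p)"
    have y: "int y = x mod int p"
      using p1 by (simp add: y_def)
    have "coprime y p"
      using \<open>coprime x (int p)\<close> y p1
      by (metis coprime_int_iff coprime_mod_left_iff of_nat_0_eq_iff not_one_less_zero)
    moreover have "y < p"
      using y p1 by (metis of_nat_less_iff pos_mod_bound of_nat_0_less_iff less_trans
          zero_less_one)
    moreover have "y > 0"
      using \<open>coprime y p\<close> p1 by (cases "y = 0") auto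
    ultimately have "y \<in> totatives p"
      by (simp add: totatives_def)
    then obtain i where "y = g ^ i mod p"
      using residue_primroot_is_generator[OF p1 g] by (auto simp: bij_betw_def)
    then have "[x = int g ^ i] (mod int p)"
      using y by (simp add: cong_def zmod_int)
    then show ?thesis ..
  qed
  moreover have "coprime p g"
    using g by (simp add: residue_primroot_def)
  ultimately show ?thesis
    using that by blast
qed

section \<open>The cyclic group of powers of \<open>h\<close>\<close>

lemma powers_mod_eq_image:
  assumes "coprime p h" "p > 1"
  shows "range (\<lambda>i. int (h ^ i mod p)) = (\<lambda>i. int (h ^ i mod p)) ` {..<ord p h}"
proof -
  have "h ^ i mod p = h ^ (i mod ord p h) mod p" for i
    using order_divides_expdiff[OF assms(1), of i "i mod ord p h"] by (simp add: cong_def)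
  \<comment> \<open>Coprimality makes \<open>ord p h\<close> positive; the value 0 is the default
    for the non-coprime case.\<close>
  moreover have "i mod ord p h < ord p h" for i
    using assms by (intro mod_less_divisor) (simp add: ord_eq_0 zero_less_iff_neq_zero)
  ultimately show ?thesis
    by (auto simp: image_iff) (metis lessThan_iff)
qed

text \<open>Multiplication by \<open>h ^ j\<close> adds \<open>j\<close> to the exponents, so powers
  of \<open>h\<close> stay powers of \<open>h\<close>.\<close>

lemma bij_betw_mult_map_powers:
  assumes "coprime p h" "p > 1"
  defines "H \<equiv> range (\<lambda>i. int (h ^ i mod p))"
  shows "bij_betw (mult_map p (int h ^ j)) H H"
proof (rule bij_betw_mult_map)
  show "coprime (int h ^ j) (int p)"
    using assms(1) by (simp add: coprime_commute)
  show "H \<subseteq> {0..int p - 1}"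
  proof
    fix x assume "x \<in> H"
    then obtain i where "x = int h ^ i mod int p"
      by (auto simp: H_def zmod_int)
    then show "x \<in> {0..int p - 1}"
      using assms(2) pos_mod_bound[of "int p" "int h ^ i"] by auto
  qed
  have "mult_map p (int h ^ j) (int (h ^ i mod p)) = int (h ^ (j + i) mod p)" for i
    by (simp add: mult_map_def zmod_int mod_mult_right_eq power_add)
  then show "mult_map p (int h ^ j) ` H \<subseteq> H"
    by (auto simp: H_def)
qed

text \<open>Each factor \<open>h\<close> composes the map with one more cycle of length
  \<open>ord p h\<close>, and the sign is multiplicative.\<close>

lemma sign_on_mult_map_power:
  assumes "coprime p h" "p > 1"
  defines "H \<equiv> range (\<lambda>i. int (h ^ i mod p))"
  shows "sign_on H (mult_map p (int h ^ j)) = (- 1) ^ ((ord p h - 1) * j)"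
proof (induction j)
  case 0
  have "mult_map p 1 x = x" if "x \<in> H" for x
    using that by (auto simp: H_def mult_map_def zmod_int)
  then have "sign_on H (mult_map p (int h ^ 0)) = sign_on H (\<lambda>x. x)"
    by (intro sign_on_cong) auto
  then show ?case by simp
next
  case (Suc j)
  define c where "c = (\<lambda>i. int (h ^ i mod p))"
  define n where "n = ord p h"
  have H: "H = c ` {..<n}"
    using powers_mod_eq_image[OF assms(1,2)] by (simp add: H_def c_def n_def)
  have c_eq_iff: "c i = c i' \<longleftrightarrow> [i = i'] (mod n)" for i i'
    using order_divides_expdiff[OF assms(1)] by (simp add: c_def n_def cong_def)
  have "sign_on H (mult_map p (int h)) = (- 1) ^ (n - 1)"
    unfolding H
  proof (rule sign_on_cyclic_shift)
    show "inj_on c {..<n}"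
      by (auto intro!: inj_onI simp: c_eq_iff cong_def)
    \<comment> \<open>The exponent wraps around at \<open>n\<close>, because exponents matter only
      modulo the order \<open>n\<close> of \<open>h\<close>.\<close>
    show "mult_map p (int h) (c i) = c (Suc i mod n)" for i
    proof -
      have "mult_map p (int h) (c i) = c (Suc i)"
        by (simp add: c_def mult_map_def zmod_int mod_mult_right_eq)
      then show ?thesis
        using c_eq_iff by (simp add: cong_def)
    qed
  qed
  moreover have "sign_on H (mult_map p (int h ^ Suc j)) =
      sign_on H (mult_map p (int h) \<circ> mult_map p (int h ^ j))"
    by (intro sign_on_cong) (auto simp: mult_map_mult)
  moreover have "\<dots> = sign_on H (mult_map p (int h)) * sign_on H (mult_map p (int h ^ j))"
    using bij_betw_mult_map_powers[OF assms(1,2), of 1]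
      bij_betw_mult_map_powers[OF assms(1,2), of j]
    by (intro sign_on_compose) (auto simp: H H_def[symmetric])
  ultimately show ?case
    using Suc by (simp add: n_def power_add)
qed

text \<open>Comparing exponents turns the claim into solvability of \<open>2 * j = i\<close> modulo
  \<open>ord p h\<close>, which can fail only when 2 divides the modulus.\<close>

lemma square_iff_ord_odd_or_even_exponent:
  fixes p h i :: nat
  assumes "coprime p h"
  shows "(\<exists>j. [h ^ (2 * j) = h ^ i] (mod p)) \<longleftrightarrow> odd (ord p h) \<or> even i"
proof
  assume "\<exists>j. [h ^ (2 * j) = h ^ i] (mod p)"
  then obtain j where "[2 * j = i] (mod ord p h)"
    using order_divides_expdiff[OF assms] by blast
  then have "[2 * j = i] (mod 2)" if "even (ord p h)"
    using that cong_dvd_modulus_nat by blast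
  then show "odd (ord p h) \<or> even i"
    by (auto simp: cong_def)
next
  assume "odd (ord p h) \<or> even i"
  \<comment> \<open>If \<open>i\<close> and the order are both odd, adding the order makes the
    exponent even without changing the power.\<close>
  then have "even i \<or> even (i + ord p h)"
    by auto
  then obtain j where "2 * j = i \<or> 2 * j = i + ord p h"
    by (metis dvd_def)
  then have "[2 * j = i] (mod ord p h)"
    by (auto simp: cong_def)
  then show "\<exists>j. [h ^ (2 * j) = h ^ i] (mod p)"
    using order_divides_expdiff[OF assms] by blast
qed

text \<open>Replaces ring powers of units by integer powers of explicit representatives.\<close>

lemma pow2_power_units_eq_image:
  assumes "prime p"
  shows "pow2_power_units p j = (\<lambda>x. x ^ (2 ^ j) mod int p) ` {1..int p - 1}"
proof -
  interpret residues_prime p "residue_ring (int p)"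
    using assms by (simp add: residues_prime_def)
  have "x [^]\<^bsub>residue_ring (int p)\<^esub> ((2::nat) ^ j) = x ^ (2 ^ j) mod int p"
    if "x \<in> {1..int p - 1}" for x
    using pow_cong[of x "2 ^ j"] that by simp
  moreover have "Units (residue_ring (int p)) = {1..int p - 1}"
    using prime_gt_0_nat[OF assms] by (simp add: res_prime_units_eq of_nat_diff)
  ultimately show ?thesis
    unfolding pow2_power_units_def by (metis (no_types, lifting) image_cong)
qed

theorem theorem5:
  fixes k p :: nat and a :: int
  assumes "k \<ge> 1"
    and "prime p"
    and "\<not> int p dvd a"
    and "pow2_residue_symbol (k - 1) a p = 1"
  shows "bij_betw (mult_map p a) (carrier (residue_ring (int p))) (carrier (residue_ring (int p)))
    \<and> bij_betw (mult_map p a) (pow2_power_units p (k - 1)) (pow2_power_units p (k - 1))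
    \<and> pow2_residue_symbol k a p = sign_on (pow2_power_units p (k - 1)) (mult_map p a)"
proof -
  have p1: "p > 1" and prime_int: "prime (int p)"
    using assms(2) prime_gt_1_nat by auto
  obtain g where g: "coprime p g"
    and gen: "\<And>x::int. \<not> int p dvd x \<Longrightarrow> \<exists>i. [x = int g ^ i] (mod int p)"
    using prime_units_cyclic[OF assms(2)] by blast
  define q :: nat where "q = 2 ^ (k - 1)"
  have q: "q > 0" "2 ^ k = q * 2"
    using assms(1) by (cases k; simp add: q_def)+
  \<comment> \<open>\<open>h\<close> generates the group of \<open>q\<close>-th powers: if
    \<open>x\<close> is \<open>g ^ i\<close> modulo \<open>p\<close>, then \<open>x ^ q\<close> is
    \<open>h ^ i\<close>.\<close>
  define h where "h = g ^ q"
  have h: "coprime p h"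
    using g by (simp add: h_def)
  have power_q: "\<exists>i. [x ^ q = int h ^ i] (mod int p)" if x: "\<not> int p dvd x" for x
  proof -
    obtain i where "[x = int g ^ i] (mod int p)"
      using gen[OF x] by blast
    then have "[x ^ q = (int g ^ i) ^ q] (mod int p)"
      by (rule cong_pow)
    moreover have "(int g ^ i) ^ q = int h ^ i"
      by (simp add: h_def mult.commute flip: power_mult)
    ultimately show ?thesis
      by auto
  qed
  \<comment> \<open>Any root of \<open>a\<close> is a unit modulo \<open>p\<close>, so
    \<open>power_q\<close> applies to it.\<close>
  have not_dvd: "\<not> int p dvd x" if "[x ^ m = a] (mod int p)" "m > 0" for x m
    using that assms(3) by (metis cong_dvd_iff dvd_power dvd_trans)

  have H: "pow2_power_units p (k - 1) = range (\<lambda>i. int (h ^ i mod p))"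
  proof (intro equalityI subsetI)
    fix y assume "y \<in> pow2_power_units p (k - 1)"
    then obtain x where x: "x \<in> {1..int p - 1}" "y = x ^ q mod int p"
      by (auto simp: pow2_power_units_eq_image[OF assms(2)] q_def)
    then have "\<not> int p dvd x"
      using zdvd_not_zless[of x "int p"] by auto
    then show "y \<in> range (\<lambda>i. int (h ^ i mod p))"
      using power_q[of x] x(2) by (auto simp: cong_def zmod_int)
  next
    fix y assume "y \<in> range (\<lambda>i. int (h ^ i mod p))"
    then obtain i where y: "y = int (h ^ i mod p)"
      by blast
    \<comment> \<open>The representative of a unit whose \<open>q\<close>-th power is
      \<open>h ^ i\<close>.\<close>
    define x where "x = int g ^ i mod int p"
    have "\<not> int p dvd int g ^ i"
      using g p1 prime_int
      by (metis coprime_int_iff coprime_absorb_left coprime_power_right_iff not_prime_unit)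
    then have "x \<noteq> 0"
      by (simp add: x_def dvd_eq_mod_eq_0)
    moreover have "0 \<le> x" "x < int p"
      using p1 by (auto simp: x_def)
    ultimately have "x \<in> {1..int p - 1}"
      by auto
    moreover have "y = x ^ q mod int p"
      by (simp add: y x_def h_def zmod_int power_mod mult.commute flip: power_mult)
    ultimately show "y \<in> pow2_power_units p (k - 1)"
      by (auto simp: pow2_power_units_eq_image[OF assms(2)] q_def)
  qed

  \<comment> \<open>The hypothesis on the symbol places \<open>a\<close> in the group generated by
    \<open>h\<close>.\<close>
  obtain x where "[x ^ q = a] (mod int p)"
    using assms(4) by (auto simp: pow2_residue_symbol_def q_def split: if_splits)
  then obtain i where i: "[a = int h ^ i] (mod int p)"
    using power_q[of x] not_dvd[of x q] q(1) by (meson cong_sym cong_trans)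

  \<comment> \<open>Since \<open>2 ^ k = q * 2\<close>, the \<open>2 ^ k\<close>-th powers of units
    are the squares of the powers of \<open>h\<close>.\<close>
  have "(\<exists>x. [x ^ 2 ^ k = a] (mod int p)) \<longleftrightarrow> (\<exists>j. [h ^ (2 * j) = h ^ i] (mod p))"
  proof
    assume "\<exists>x. [x ^ 2 ^ k = a] (mod int p)"
    then obtain x where x: "[x ^ 2 ^ k = a] (mod int p)"
      by blast
    then obtain j where "[x ^ q = int h ^ j] (mod int p)"
      using power_q[of x] not_dvd[of x "2 ^ k"] by auto
    then have "[x ^ 2 ^ k = (int h ^ j) ^ 2] (mod int p)"
      unfolding q(2) power_mult by (rule cong_pow)
    then have "[int h ^ (2 * j) = int h ^ i] (mod int p)"
      using x i by (metis cong_sym cong_trans mult.commute power_mult)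
    then show "\<exists>j. [h ^ (2 * j) = h ^ i] (mod p)"
      by (metis cong_int_iff of_nat_power)
  next
    assume "\<exists>j. [h ^ (2 * j) = h ^ i] (mod p)"
    then obtain j where "[int h ^ (2 * j) = int h ^ i] (mod int p)"
      by (metis cong_int_iff of_nat_power)
    \<comment> \<open>The root sought is \<open>g ^ j\<close>.\<close>
    moreover have "int h ^ (2 * j) = (int g ^ j) ^ 2 ^ k"
      unfolding q(2) by (simp add: h_def mult_ac flip: power_mult)
    ultimately show "\<exists>x. [x ^ 2 ^ k = a] (mod int p)"
      using i by (metis cong_sym cong_trans)
  qed
  then have "pow2_residue_symbol k a p = (if odd (ord p h) \<or> even i then 1 else - 1)"
    using square_iff_ord_odd_or_even_exponent[OF h] by (simp add: pow2_residue_symbol_def)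
  \<comment> \<open>The order is positive, so the natural-number subtraction of 1 really flips its
    parity.\<close>
  also have "\<dots> = (- 1) ^ ((ord p h - 1) * i)"
    using h by (cases "ord p h") (auto simp: ord_eq_0)
  also have "\<dots> = sign_on (pow2_power_units p (k - 1)) (mult_map p a)"
    unfolding H mult_map_cong[OF i] by (rule sign_on_mult_map_power[OF h p1, symmetric])
  finally have symbol: "pow2_residue_symbol k a p =
    sign_on (pow2_power_units p (k - 1)) (mult_map p a)" .
  have "bij_betw (mult_map p a) (pow2_power_units p (k - 1)) (pow2_power_units p (k - 1))"
    unfolding H mult_map_cong[OF i] by (rule bij_betw_mult_map_powers[OF h p1])
  moreover have "bij_betw (mult_map p a) {0..int p - 1} {0..int p - 1}"
  proof (rule bij_betw_mult_map)
    show "coprime a (int p)"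
      using assms(3) prime_int by (metis coprime_commute prime_imp_coprime)
    show "mult_map p a ` {0..int p - 1} \<subseteq> {0..int p - 1}"
      using p1 by (auto simp: mult_map_def)
  qed simp
  ultimately show ?thesis
    using symbol by (simp add: residue_ring_def)
qed

end
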